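(* Let $a_0\in\mathbb{C}\setminus\{0\}$. (i) For every $n\in\mathbb{N}$ let $y_n(t)$ be the $n$-series algebroid solution and $z=\left(\frac{2n+3}{4}\right)^6t^4$ (definitions in the context). There exist meromorphic functions $g^n_k(z)$, $z\in\mathbb{C}$, $k=1,\ldots,2n+3$, such that $$\sum_{k=1}^{2n+3}g^n_k(z)\,(t\,y_n(t))^k-1=0 .$$ (ii) For every $m\in\mathbb{Z}_{\geqslant0}$ let $y_{-m}(t)$ be the $m$-series algebroid solution, $d=\gcd(m+3,4)$, $p=(m+3)/d$, $z=c_-^{-p}\,t^{4/d}$ (definitions in the context). There exist meromorphic functions $g^{-m}_k(z)$, $z\in\mathbb{C}$, $k=1,\ldots,p$, such that $$\sum_{k=1}^{p}g^{-m}_k(z)\,(t\,y_{-m}(t))^k-1=0 .$$ Moreover, these polynomials (in the unknown $ty_n$, respectively $ty_{-m}$) are irreducible over the field of meromorphic functions of $z$ on $\mathbb{C}$.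
   Context: All functions $y$ below are solutions of the degenerate third Painlevé equation $\left(\frac{ty'(t)}{y(t)}\right)'=y(t)-\frac{t}{(y(t))^2}$. For $n\in\mathbb{Z}_{\geqslant0}$, $H_n(\hat x)$ is the unique solution holomorphic at $\hat x=0$ with $H_n(0)=-a_0$ of $\left(\frac{\hat xH_n'}{H_n}\right)'=\hat x^nH_n-\frac1{H_n^2}$; for $m\in\mathbb{N}$, $H_{-m}(\hat x)$ is the unique solution holomorphic at $\hat x=0$ with $H_{-m}(0)=-a_0$ of $\left(\frac{\hat xH_{-m}'}{H_{-m}}\right)'=2\left(H_{-m}-\frac{\hat x^m}{H_{-m}^2}\right)$. With the positive constant $c_+$ determined by $\left(\frac{2n+3}{4}\right)^2c_+^{\frac{2n+3}{3}}=1$, put $$t\,y_n(t)=c_+^{-\frac n3}\,t^{\frac{4(n+1)}{2n+3}}\,H_n\!\left(c_+^{-1}t^{\frac4{2n+3}}\right),\qquad n\geqslant 0;$$ so $z=c_+^{-(2n+3)}t^4$ in (i). With the positive constant $c_-$ determined by $\left(\frac{m+3}{4}\right)^2c_-^{\frac{m+3}{3}}=2$, put $$t\,y_{-m}(t)=c_-^{\frac m3}\,t^{\frac4{m+3}}\,H_{-m}\!\left(c_-^{-1}t^{\frac4{m+3}}\right),\qquad m\geqslant1.$$ For $m=0$ the solution $y_{-0}=y_0$ is the one given by the first formula with $n=0$, and $c_-$ in the definition of $z$ is replaced by $c_+|_{n=0}=16/9$. The functions $H_n$, $H_{-m}$ continue to meromorphic functions on $\mathbb{C}$. The fractional powers are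 branches continued consistently on the Riemann surface of the logarithm; the identities hold for all branches. *)

theory Defs
  imports
    "HOL-Complex_Analysis.Complex_Analysis"
    "HOL-Computational_Algebra.Computational_Algebra"
begin

section \<open>The field of meromorphic functions on the complex plane\<close>

text \<open>
  A meromorphic function is represented by its unique \<open>nicely meromorphic\<close> representative, i.e.
  the one that has no removable singularities and takes the value 0 at its poles. Since the
  pointwise sum and product of such representatives may have removable singularities, these have
  to be removed explicitly.
\<close>

typedef mero = "{f :: complex \<Rightarrow> complex. f nicely_meromorphic_on UNIV}"
  morphisms eval_mero Abs_mero
  by (rule exI[of _ "\<lambda>_. 0"]) auto

lemma eval_mero_nicely: "eval_mero f nicely_meromorphic_on UNIV"
  using eval_mero[of f] by simp

lemma eval_mero_meromorphic [meromorphic_intros]: "eval_mero f meromorphic_on A"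
  using eval_mero_nicely[of f] meromorphic_on_subset[of "eval_mero f" UNIV A]
  by (auto simp: nicely_meromorphic_on_def)

lemma remove_sings_eval_mero: "remove_sings (eval_mero f) z = eval_mero f z"
  using eval_mero_nicely[of f]
  by (metis UNIV_I nicely_meromorphic_on_def remove_sings_at_pole remove_sings_eqI)

lemma mero_eqI:
  assumes "\<forall>\<^sub>\<approx>z\<in>UNIV. eval_mero f z = eval_mero g z"
  shows   "f = g"
proof -
  have "eval_mero f z = eval_mero g z" for z
  proof -
    have "\<forall>\<^sub>F w in at z. eval_mero f w = eval_mero g w"
      using assms by (simp add: eventually_cosparse_open_eq)
    from remove_sings_cong[OF this refl] show ?thesis
      by (simp add: remove_sings_eval_mero)
  qed
  hence "eval_mero f = eval_mero g" by blast
  thus ?thesis by (simp add: eval_mero_inject)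
qed

definition mero_of_fun :: "(complex \<Rightarrow> complex) \<Rightarrow> mero" where
  "mero_of_fun f = Abs_mero (remove_sings f)"

lemma eval_mero_of_fun:
  assumes "f meromorphic_on UNIV"
  shows   "eval_mero (mero_of_fun f) = remove_sings f"
  using remove_sings_nicely_meromorphic[OF assms]
  by (simp add: mero_of_fun_def Abs_mero_inverse)

lemma eventually_eval_mero_of_fun:
  assumes "f meromorphic_on UNIV"
  shows   "\<forall>\<^sub>\<approx>z\<in>UNIV. eval_mero (mero_of_fun f) z = f z"
  using eventually_remove_sings_eq[OF assms] by (simp add: eval_mero_of_fun[OF assms])

instantiation mero :: field
begin

definition "0 = mero_of_fun (\<lambda>_. 0)"
definition "1 = mero_of_fun (\<lambda>_. 1)"
definition "f + g = mero_of_fun (\<lambda>z. eval_mero f z + eval_mero g z)"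
definition "f - g = mero_of_fun (\<lambda>z. eval_mero f z - eval_mero g z)"
definition "- f = mero_of_fun (\<lambda>z. - eval_mero f z)"
definition "f * g = mero_of_fun (\<lambda>z. eval_mero f z * eval_mero g z)"
definition "inverse f = mero_of_fun (\<lambda>z. inverse (eval_mero f z))"
definition "f div g = mero_of_fun (\<lambda>z. eval_mero f z / eval_mero g z)"

lemma eval_mero_0: "eval_mero 0 z = 0"
  unfolding zero_mero_def by (subst eval_mero_of_fun) (auto intro!: meromorphic_intros)

lemma eval_mero_1: "eval_mero 1 z = 1"
  unfolding one_mero_def by (subst eval_mero_of_fun) (auto intro!: meromorphic_intros)

lemma
  shows eval_mero_add: "\<forall>\<^sub>\<approx>z\<in>UNIV. eval_mero (f + g) z = eval_mero f z + eval_mero g z"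
    and eval_mero_diff: "\<forall>\<^sub>\<approx>z\<in>UNIV. eval_mero (f - g) z = eval_mero f z - eval_mero g z"
    and eval_mero_uminus: "\<forall>\<^sub>\<approx>z\<in>UNIV. eval_mero (- f) z = - eval_mero f z"
    and eval_mero_mult: "\<forall>\<^sub>\<approx>z\<in>UNIV. eval_mero (f * g) z = eval_mero f z * eval_mero g z"
    and eval_mero_inverse: "\<forall>\<^sub>\<approx>z\<in>UNIV. eval_mero (inverse f) z = inverse (eval_mero f z)"
    and eval_mero_divide: "\<forall>\<^sub>\<approx>z\<in>UNIV. eval_mero (f div g) z = eval_mero f z / eval_mero g z"
  unfolding plus_mero_def minus_mero_def uminus_mero_def times_mero_def inverse_mero_def
    divide_mero_def
  by (intro eventually_eval_mero_of_fun meromorphic_intros)+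

instance
proof
  fix a b c :: mero
  show "a + b + c = a + (b + c)"
    by (rule mero_eqI, use eval_mero_add[of a b] eval_mero_add[of "a + b" c] eval_mero_add[of b c]
      eval_mero_add[of a "b + c"] in eventually_elim) simp
  show "a + b = b + a"
    by (rule mero_eqI, use eval_mero_add[of a b] eval_mero_add[of b a] in eventually_elim) simp
  show "0 + a = a"
    by (rule mero_eqI, use eval_mero_add[of 0 a] in eventually_elim) (simp add: eval_mero_0)
  show "- a + a = 0"
    by (rule mero_eqI,
        use eval_mero_add[of "- a" a] eval_mero_uminus[of a]
        in eventually_elim) (simp add: eval_mero_0)
  show "a - b = a + - b"
    by (rule mero_eqI,
        use eval_mero_add[of a "- b"] eval_mero_uminus[of b] eval_mero_diff[of a b]
        in eventually_elim) simp
  show "a * b * c = a * (b * c)"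
    by (rule mero_eqI, use eval_mero_mult[of a b] eval_mero_mult[of "a * b" c] eval_mero_mult[of b c]
      eval_mero_mult[of a "b * c"] in eventually_elim) simp
  show "a * b = b * a"
    by (rule mero_eqI, use eval_mero_mult[of a b] eval_mero_mult[of b a] in eventually_elim) simp
  show "1 * a = a"
    by (rule mero_eqI, use eval_mero_mult[of 1 a] in eventually_elim) (simp add: eval_mero_1)
  show "(a + b) * c = a * c + b * c"
    by (rule mero_eqI, use eval_mero_add[of a b] eval_mero_mult[of "a + b" c] eval_mero_mult[of a c]
      eval_mero_mult[of b c] eval_mero_add[of "a * c" "b * c"] in eventually_elim) (simp add: algebra_simps)
  show "(0 :: mero) \<noteq> 1"
    using eval_mero_0 eval_mero_1 by (metis zero_neq_one)
  show "a div b = a * inverse b"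
    by (rule mero_eqI,
        use eval_mero_mult[of a "inverse b"] eval_mero_inverse[of b] eval_mero_divide[of a b]
        in eventually_elim) (simp add: field_simps)
  show "inverse (0 :: mero) = 0"
    by (rule mero_eqI, use eval_mero_inverse[of 0] in eventually_elim) (simp add: eval_mero_0)
  show "inverse a * a = 1" if "a \<noteq> 0"
  proof -
    have "\<not> (\<forall>x\<in>UNIV. eval_mero a x = 0)"
      using that by (metis UNIV_I eval_mero_0 eval_mero_inject ext)
    hence "\<forall>\<^sub>\<approx>x\<in>UNIV. eval_mero a x \<noteq> 0"
      using nicely_meromorphic_imp_constant_or_avoid[OF eval_mero_nicely[of a]] by auto
    with eval_mero_mult[of "inverse a" a] eval_mero_inverse[of a]
    have "\<forall>\<^sub>\<approx>z\<in>UNIV. eval_mero (inverse a * a) z = eval_mero 1 z"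
      by eventually_elim (simp add: eval_mero_1)
    thus ?thesis
      by (rule mero_eqI)
  qed
qed

end


section \<open>Algebroid solutions of the degenerate third Painleve equation\<close>

definition H_plus_eq :: "complex \<Rightarrow> nat \<Rightarrow> (complex \<Rightarrow> complex) \<Rightarrow> bool" where
  "H_plus_eq a0 n H \<longleftrightarrow> H analytic_on {0} \<and> H 0 = - a0 \<and>
     (\<forall>\<^sub>F x in nhds 0. deriv (\<lambda>u. u * deriv H u / H u) x = x ^ n * H x - 1 / H x ^ 2)"

definition H_minus_eq :: "complex \<Rightarrow> nat \<Rightarrow> (complex \<Rightarrow> complex) \<Rightarrow> bool" where
  "H_minus_eq a0 m H \<longleftrightarrow> H analytic_on {0} \<and> H 0 = - a0 \<and>
     (\<forall>\<^sub>F x in nhds 0. deriv (\<lambda>u. u * deriv H u / H u) x = 2 * (H x - x ^ m / H x ^ 2))"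

text \<open>
  The two predicates determine the germ of \<open>H\<close> at 0. The functions of the theory are the
  meromorphic continuations of these germs to the complex plane (again in their nicely meromorphic
  representation).
\<close>

definition is_H_plus :: "complex \<Rightarrow> nat \<Rightarrow> (complex \<Rightarrow> complex) \<Rightarrow> bool" where
  "is_H_plus a0 n H \<longleftrightarrow> H nicely_meromorphic_on UNIV \<and> H_plus_eq a0 n H"

definition is_H_minus :: "complex \<Rightarrow> nat \<Rightarrow> (complex \<Rightarrow> complex) \<Rightarrow> bool" where
  "is_H_minus a0 m H \<longleftrightarrow> H nicely_meromorphic_on UNIV \<and> H_minus_eq a0 m H"

definition c_plus :: "nat \<Rightarrow> real" where
  "c_plus n = (THE c. c > 0 \<and>
     ((2 * real n + 3) / 4) ^ 2 * c powr ((2 * real n + 3) / 3) = 1)"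

definition c_minus :: "nat \<Rightarrow> real" where
  "c_minus m = (THE c. c > 0 \<and> ((real m + 3) / 4) ^ 2 * c powr ((real m + 3) / 3) = 2)"

lemma ex1_powr_eq:
  fixes A e b :: real
  assumes "A > 0" "e > 0" "b > 0"
  shows   "\<exists>!c. c > 0 \<and> A * c powr e = b"
proof (rule ex1I[of _ "(b / A) powr (1 / e)"])
  show "0 < (b / A) powr (1 / e) \<and> A * ((b / A) powr (1 / e)) powr e = b"
    using assms by (simp add: powr_powr)
next
  fix c assume c: "c > 0 \<and> A * c powr e = b"
  hence "c powr e = b / A" using assms by (auto simp: field_simps)
  hence "(b / A) powr (1 / e) = (c powr e) powr (1 / e)" by simp
  also have "\<dots> = c" using c assms by (simp add: powr_powr)
  finally show "c = (b / A) powr (1 / e)" by simp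
qed

lemma c_plus:
  "c_plus n > 0" "((2 * real n + 3) / 4) ^ 2 * c_plus n powr ((2 * real n + 3) / 3) = 1"
  using theI'[OF ex1_powr_eq[of "((2 * real n + 3) / 4) ^ 2" "(2 * real n + 3) / 3" 1]]
  unfolding c_plus_def by auto

lemma c_minus:
  "c_minus m > 0" "((real m + 3) / 4) ^ 2 * c_minus m powr ((real m + 3) / 3) = 2"
  using theI'[OF ex1_powr_eq[of "((real m + 3) / 4) ^ 2" "(real m + 3) / 3" 2]]
  unfolding c_minus_def by auto

lemma c_plus_0: "c_plus 0 = 16 / 9"
  using c_plus[of 0] by (simp add: field_simps)

text \<open>
  Functions on the Riemann surface of the logarithm are functions of \<open>s = ln t \<in> \<complex>\<close>, i.e.
  \<open>t = exp s\<close> and \<open>t\<^sup>\<alpha> = exp (\<alpha> s)\<close>. Letting \<open>s\<close> range over all complex numbers covers all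
  branches of the fractional powers.
\<close>

definition y_plus :: "nat \<Rightarrow> (complex \<Rightarrow> complex) \<Rightarrow> complex \<Rightarrow> complex" where
  "y_plus n H s =
     of_real (c_plus n powr (- real n / 3)) *
     exp (of_real (4 * (real n + 1) / (2 * real n + 3)) * s) *
     H (of_real (1 / c_plus n) * exp (of_real (4 / (2 * real n + 3)) * s)) / exp s"

definition y_minus :: "nat \<Rightarrow> (complex \<Rightarrow> complex) \<Rightarrow> complex \<Rightarrow> complex" where
  "y_minus m H s =
     of_real (c_minus m powr (real m / 3)) *
     exp (of_real (4 / (real m + 3)) * s) *
     H (of_real (1 / c_minus m) * exp (of_real (4 / (real m + 3)) * s)) / exp s"

text \<open>
  The \<open>m\<close>-series for all \<open>m \<ge> 0\<close>, with its member for \<open>m = 0\<close> taken from the \<open>n\<close>-series.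
\<close>

definition is_H_mseries :: "complex \<Rightarrow> nat \<Rightarrow> (complex \<Rightarrow> complex) \<Rightarrow> bool" where
  "is_H_mseries a0 m H \<longleftrightarrow> (if m = 0 then is_H_plus a0 0 H else is_H_minus a0 m H)"

definition c_mseries :: "nat \<Rightarrow> real" where
  "c_mseries m = (if m = 0 then c_plus 0 else c_minus m)"

definition y_mseries :: "nat \<Rightarrow> (complex \<Rightarrow> complex) \<Rightarrow> complex \<Rightarrow> complex" where
  "y_mseries m H = (if m = 0 then y_plus 0 H else y_minus m H)"


text \<open>
  The identity \<open>\<Sum>\<^sub>k g\<^sub>k(z) (t y)\<^sup>k - 1 = 0\<close> between meromorphic functions of \<open>s = ln t\<close>: it holds
  at every point where none of the functions involved has a pole.
\<close>

definition algebroid_identity ::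
  "nat \<Rightarrow> (nat \<Rightarrow> mero) \<Rightarrow> (complex \<Rightarrow> complex) \<Rightarrow> (complex \<Rightarrow> complex) \<Rightarrow> bool" where
  "algebroid_identity p g z y \<longleftrightarrow>
     (\<forall>s. \<not> is_pole y s \<and> (\<forall>k\<in>{1..p}. \<not> is_pole (eval_mero (g k)) (z s)) \<longrightarrow>
          (\<Sum>k=1..p. eval_mero (g k) (z s) * (exp s * y s) ^ k) - 1 = 0)"

definition algebroid_poly :: "nat \<Rightarrow> (nat \<Rightarrow> mero) \<Rightarrow> mero poly" where
  "algebroid_poly p g = (\<Sum>k=1..p. monom (g k) k) - 1"

end

theory Submission
  imports Defs
begin

text \<open>
  In the variable \<open>x = c\<^sup>-\<^sup>1 t\<^sup>\<alpha>\<close> both series take the form \<open>t y = F(x) = C x\<^sup>r H(x)\<close> and \<open>z = x\<^sup>p\<close>,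
  with \<open>H(0) \<noteq> 0\<close> and \<open>r\<close> coprime to \<open>p\<close>. Let \<open>\<omega>\<close> be a primitive \<open>p\<close>-th root of unity. The
  coefficients of the product of all \<open>T - F(\<omega>\<^sup>j x)\<close>, \<open>j < p\<close>, are invariant under \<open>x \<mapsto> \<omega> x\<close> and
  are thus meromorphic functions of \<open>z\<close>. Any polynomial over this field that annihilates \<open>F\<close> has
  all the conjugates \<open>F(\<omega>\<^sup>j x)\<close> as roots, and these are distinct because their leading
  coefficients at 0 differ by the factors \<open>\<omega>\<^sup>j\<^sup>r\<close>. Hence the product is the minimal polynomial
  of \<open>F\<close>, and dividing by minus its constant term gives the required equation.
\<close>

section \<open>Pullback of meromorphic functions along monomials\<close>

text \<open>The limit is a punctured one: the equation \<open>z ^ q = z0 ^ q\<close> has finitely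
  many solutions, so near \<open>z0\<close> the monomial avoids the value it takes there. This is
  what lets poles and generic identities pass through the substitution.\<close>

lemma filterlim_at_monomial:
  fixes c z0 :: complex
  assumes "c \<noteq> 0" "q > 0"
  shows   "filterlim (\<lambda>z. c * z ^ q) (at (c * z0 ^ q)) (at z0)"
  unfolding filterlim_at
proof
  show "((\<lambda>z. c * z ^ q) \<longlongrightarrow> c * z0 ^ q) (at z0)"
    by (intro tendsto_intros)
  have "finite ({z. z ^ q = z0 ^ q} - {z0})"
    using finite_nth_roots[of q "z0 ^ q"] assms by auto
  hence "open (- ({z. z ^ q = z0 ^ q} - {z0}))"
    by (intro open_Compl finite_imp_closed)
  hence "\<forall>\<^sub>F z in at z0. z \<in> - ({z. z ^ q = z0 ^ q} - {z0})"
    unfolding eventually_at_topological by blast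
  moreover have "\<forall>\<^sub>F z in at z0. z \<noteq> z0"
    by (simp add: eventually_at_filter)
  ultimately show "\<forall>\<^sub>F z in at z0. c * z ^ q \<in> UNIV \<and> c * z ^ q \<noteq> c * z0 ^ q"
    by eventually_elim (use assms in auto)
qed

text \<open>By the punctured limit, both alternatives at a point (a pole with value 0, or
  continuity) survive composition, so the composite is already in normal form.\<close>

lemma nicely_meromorphic_on_monomial:
  assumes "f nicely_meromorphic_on UNIV" "c \<noteq> 0" "q > 0"
  shows   "(\<lambda>z. f (c * z ^ q)) nicely_meromorphic_on UNIV"
  unfolding nicely_meromorphic_on_def
proof (intro conjI ballI)
  show "(\<lambda>z. f (c * z ^ q)) meromorphic_on UNIV"
    using assms(1) unfolding nicely_meromorphic_on_def
    by (intro meromorphic_on_compose[of f UNIV "\<lambda>z. c * z ^ q"]) (auto intro!: analytic_intros)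
next
  fix z
  note lim = filterlim_at_monomial[OF assms(2,3), of z]
  have "is_pole f (c * z ^ q) \<and> f (c * z ^ q) = 0 \<or> f \<midarrow>c * z ^ q\<rightarrow> f (c * z ^ q)"
    using assms(1) by (auto simp: nicely_meromorphic_on_def)
  thus "is_pole (\<lambda>z. f (c * z ^ q)) z \<and> f (c * z ^ q) = 0 \<or>
        (\<lambda>z. f (c * z ^ q)) \<midarrow>z\<rightarrow> f (c * z ^ q)"
    unfolding is_pole_def using filterlim_compose[of f _ _ "\<lambda>z. c * z ^ q", OF _ lim] by metis
qed

text \<open>Two instances matter: c = 1, q = p embeds the field of functions of z into that of
  functions of x via \<open>z = x ^ p\<close>; q = 1 with c a root of unity is a rotation, acting as
  a Galois conjugation over the image of that embedding.\<close>

definition mero_pullback :: "complex \<Rightarrow> nat \<Rightarrow> mero \<Rightarrow> mero" where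
  "mero_pullback c q f = Abs_mero (\<lambda>z. eval_mero f (c * z ^ q))"

lemma eval_mero_pullback:
  assumes "c \<noteq> 0" "q > 0"
  shows   "eval_mero (mero_pullback c q f) z = eval_mero f (c * z ^ q)"
  unfolding mero_pullback_def
  using nicely_meromorphic_on_monomial[OF eval_mero_nicely[of f] assms]
  by (simp add: Abs_mero_inverse)

lemma mero_eqI':
  assumes "\<And>z. eval_mero f z = eval_mero g z"
  shows   "f = g"
  by (rule mero_eqI) (simp add: assms)

text \<open>Field operations on \<open>mero\<close> agree with pointwise ones only off a sparse set;
  this transports such generic identities, so that pullbacks become ring homomorphisms.\<close>

lemma eventually_pullback:
  fixes P :: "complex \<Rightarrow> bool"
  assumes "\<forall>\<^sub>\<approx>z\<in>UNIV. P z" "c \<noteq> 0" "q > 0"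
  shows   "\<forall>\<^sub>\<approx>z\<in>UNIV. P (c * z ^ q)"
proof -
  have "\<forall>\<^sub>F z in at z0. P (c * z ^ q)" for z0
    using assms(1) filterlim_at_monomial[OF assms(2,3), of z0]
    by (auto simp: eventually_cosparse_open_eq filterlim_iff)
  thus ?thesis by (simp add: eventually_cosparse_open_eq)
qed

lemma mero_pullback_0 [simp]: "c \<noteq> 0 \<Longrightarrow> q > 0 \<Longrightarrow> mero_pullback c q 0 = 0"
  and mero_pullback_1 [simp]: "c \<noteq> 0 \<Longrightarrow> q > 0 \<Longrightarrow> mero_pullback c q 1 = 1"
  by (rule mero_eqI'; simp add: eval_mero_pullback eval_mero_0 eval_mero_1)+

lemma mero_pullback_add:
  assumes "c \<noteq> 0" "q > 0"
  shows   "mero_pullback c q (f + g) = mero_pullback c q f + mero_pullback c q g"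
  by (rule mero_eqI,
      use eventually_pullback[OF eval_mero_add[of f g] assms]
          eval_mero_add[of "mero_pullback c q f" "mero_pullback c q g"] in eventually_elim)
     (simp add: eval_mero_pullback assms)

lemma mero_pullback_mult:
  assumes "c \<noteq> 0" "q > 0"
  shows   "mero_pullback c q (f * g) = mero_pullback c q f * mero_pullback c q g"
  by (rule mero_eqI,
      use eventually_pullback[OF eval_mero_mult[of f g] assms]
          eval_mero_mult[of "mero_pullback c q f" "mero_pullback c q g"] in eventually_elim)
     (simp add: eval_mero_pullback assms)

lemma mero_pullback_minus:
  assumes "c \<noteq> 0" "q > 0"
  shows   "mero_pullback c q (- f) = - mero_pullback c q f"
  using mero_pullback_add[OF assms, of "- f" f] assms
  by (simp add: eq_neg_iff_add_eq_0)

text \<open>A unital homomorphism out of a field is injective: if f is nonzero, the image of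
  \<open>f * inverse f\<close> is 1.\<close>

lemma mero_pullback_eq_0_iff:
  assumes "c \<noteq> 0" "q > 0"
  shows   "mero_pullback c q f = 0 \<longleftrightarrow> f = 0"
proof
  assume "mero_pullback c q f = 0"
  moreover have "mero_pullback c q (f * inverse f) = mero_pullback c q f * mero_pullback c q (inverse f)"
    by (rule mero_pullback_mult[OF assms])
  ultimately show "f = 0"
    using assms by (cases "f = 0") auto
qed (use assms in auto)

lemma mero_pullback_pullback:
  assumes "a \<noteq> 0" "b \<noteq> 0" "q > 0" "r > 0"
  shows   "mero_pullback a q (mero_pullback b r f) = mero_pullback (b * a ^ r) (q * r) f"
  by (rule mero_eqI')
     (simp add: eval_mero_pullback assms power_mult_distrib power_mult mult.assoc)

lemma mero_pullback_id [simp]: "mero_pullback 1 (Suc 0) f = f"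
  by (rule mero_eqI') (simp add: eval_mero_pullback)


section \<open>Polynomials over the field of meromorphic functions\<close>

lemma hom_sum:
  fixes h :: "'a :: comm_monoid_add \<Rightarrow> 'b :: comm_monoid_add"
  assumes "h 0 = 0" "\<And>x y. h (x + y) = h x + h y"
  shows   "h (sum f A) = (\<Sum>x\<in>A. h (f x))"
  by (induction A rule: infinite_finite_induct) (simp_all add: assms)

lemma map_poly_mult_hom:
  fixes h :: "'a :: comm_semiring_0 \<Rightarrow> 'b :: comm_semiring_0"
  assumes "h 0 = 0" "\<And>x y. h (x + y) = h x + h y" "\<And>x y. h (x * y) = h x * h y"
  shows   "map_poly h (p * q) = map_poly h p * map_poly h q"
  by (rule poly_eqI) (simp add: coeff_map_poly coeff_mult assms hom_sum[of h])

lemma map_poly_prod_hom: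
  fixes h :: "'a :: comm_semiring_1 \<Rightarrow> 'b :: comm_semiring_1"
  assumes "h 0 = 0" "h 1 = 1" "\<And>x y. h (x + y) = h x + h y" "\<And>x y. h (x * y) = h x * h y"
  shows   "map_poly h (prod f A) = (\<Prod>x\<in>A. map_poly h (f x))"
  by (induction A rule: infinite_finite_induct)
     (simp_all add: map_poly_mult_hom assms)

text \<open>When \<open>h\<close> fixes the coefficients of \<open>p\<close>, this shows that
  \<open>h\<close> sends roots of \<open>p\<close> to roots of \<open>p\<close>.\<close>

lemma poly_map_poly_hom:
  fixes h :: "'a :: comm_ring_1 \<Rightarrow> 'b :: comm_ring_1"
  assumes "h 0 = 0" "\<And>x y. h (x + y) = h x + h y" "\<And>x y. h (x * y) = h x * h y"
  shows   "h (poly p x) = poly (map_poly h p) (h x)"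
  by (induction p) (simp_all add: assms map_poly_pCons)

lemma coeff_algebroid_poly:
  "coeff (algebroid_poly p g) k = (if k = 0 then -1 else if k \<le> p then g k else 0)"
  by (auto simp: algebroid_poly_def coeff_sum coeff_diff)

lemma eventually_eval_mero_sum:
  "\<forall>\<^sub>\<approx>z\<in>UNIV. eval_mero (sum f A) z = (\<Sum>k\<in>A. eval_mero (f k) z)"
proof (induction A rule: infinite_finite_induct)
  case (insert x A)
  show ?case
    using insert.IH eval_mero_add[of "f x" "sum f A"]
    by eventually_elim (use insert.hyps in simp)
qed (simp_all add: eval_mero_0)

lemma eventually_eval_mero_power:
  "\<forall>\<^sub>\<approx>z\<in>UNIV. eval_mero (f ^ k) z = eval_mero f z ^ k"
proof (induction k)
  case (Suc k)
  show ?case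
    using Suc.IH eval_mero_mult[of f "f ^ k"] by eventually_elim simp
qed (simp_all add: eval_mero_1)


section \<open>Descent along the power map\<close>

text \<open>
  A function invariant under multiplication by \<open>p\<close>-th roots of unity is constant on the fibres of
  \<open>x \<mapsto> x\<^sup>p\<close>. Away from 0 the quotient function is locally \<open>f\<close> composed with a holomorphic
  branch of the \<open>p\<close>-th root; at 0 it has a limit or a pole since the root is continuous there.
\<close>

lemma mero_descent:
  fixes f :: mero
  assumes p: "p > 0"
  assumes inv: "\<And>x y. x ^ p = y ^ p \<Longrightarrow> eval_mero f x = eval_mero f y"
  shows   "\<exists>g. mero_pullback 1 p g = f"
proof -
  have "\<exists>w::complex. w ^ p = z" for z
  proof (cases "z = 0")
    case False
    hence "exp (Ln z / of_nat p) ^ p = z"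
      using p exp_divide_power_eq[of p "Ln z"] by simp
    thus ?thesis by blast
  qed (use p in \<open>auto intro: exI[of _ 0]\<close>)
  \<comment> \<open>The choice \<open>w\<close> of roots is arbitrary and may be discontinuous; by
    \<open>inv\<close>, the function \<open>G\<close> below does not depend on it.\<close>
  then obtain w :: "complex \<Rightarrow> complex" where w: "\<And>z. w z ^ p = z"
    by metis
  have w_nz: "w z \<noteq> 0" if "z \<noteq> 0" for z
    using w[of z] that p by (metis power_eq_0_iff)
  have norm_w: "norm (w z) = root p (norm z)" for z
    using w[of z] p by (metis norm_ge_zero norm_power real_root_power_cancel)
  define G where "G = (\<lambda>z. eval_mero f (w z))"

  have branch: "\<exists>\<rho>. \<rho> analytic_on {z0} \<and> \<rho> z0 = w z0 \<and> (\<forall>\<^sub>F z in nhds z0. G z = eval_mero f (\<rho> z))"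
    if z0: "z0 \<noteq> 0" for z0
  proof -
    \<comment> \<open>Taking the logarithm of \<open>z / z0\<close>, which is 1 at
      \<open>z0\<close>, keeps the branch cut away whatever the argument of \<open>z0\<close>
      is.\<close>
    define \<rho> where "\<rho> = (\<lambda>z. w z0 * exp (Ln (z / z0) / of_nat p))"
    have "\<rho> analytic_on {z0}"
      unfolding \<rho>_def using z0 p by (intro analytic_intros) auto
    moreover have "\<rho> z0 = w z0"
      using z0 by (simp add: \<rho>_def)
    moreover have "\<rho> z ^ p = z" if "z \<noteq> 0" for z
      using that z0 p exp_divide_power_eq[of p "Ln (z / z0)"]
      by (simp add: \<rho>_def power_mult_distrib w)
    hence "\<forall>\<^sub>F z in nhds z0. G z = eval_mero f (\<rho> z)"
      using t1_space_nhds[OF z0] unfolding G_def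
      by (auto elim!: eventually_mono intro!: inv simp: w)
    ultimately show ?thesis by blast
  qed

  have mero: "G meromorphic_on {z0}" for z0
  proof (cases "z0 = 0")
    case False
    then obtain \<rho> where \<rho>: "\<rho> analytic_on {z0}" "\<forall>\<^sub>F z in nhds z0. G z = eval_mero f (\<rho> z)"
      using branch by blast
    have "(\<lambda>z. eval_mero f (\<rho> z)) meromorphic_on {z0}"
      by (rule meromorphic_on_compose[OF eval_mero_meromorphic[of f UNIV] \<rho>(1)]) auto
    also have "?this \<longleftrightarrow> G meromorphic_on {z0}"
      using \<rho>(2) by (intro meromorphic_on_cong) (auto simp: eventually_nhds_conv_at elim: eventually_mono)
    finally show ?thesis .
  next
    case True
    have "((\<lambda>z. norm (w z)) \<longlongrightarrow> 0) (at 0)"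
      unfolding norm_w by (rule tendsto_eq_intros | simp)+
    hence lim: "filterlim w (at 0) (at 0)"
      unfolding filterlim_at tendsto_norm_zero_iff
      using w_nz by (auto simp: eventually_at_filter)
    have f: "isolated_singularity_at (eval_mero f) 0" "not_essential (eval_mero f) 0"
      using eval_mero_meromorphic[of f "{0}"] by (auto simp: meromorphic_at_iff)
    have "filterlim G \<F> (at 0)" if "filterlim (eval_mero f) \<F> (at 0)" for \<F>
      unfolding G_def by (rule filterlim_compose[OF that lim])
    hence "not_essential G 0"
      using f(2) unfolding not_essential_def is_pole_def by metis
    moreover have "isolated_singularity_at G 0"
    proof -
      obtain e where e: "e > 0" "eval_mero f analytic_on ball 0 e - {0}"
        using f(1) by (auto simp: isolated_singularity_at_def)
      \<comment> \<open>The radius \<open>e ^ p\<close> is the one for which p-th roots land in the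
        punctured ball of radius e where f is analytic.\<close>
      have "G analytic_on {z}" if z: "z \<in> ball 0 (e ^ p) - {0}" for z
      proof -
        obtain \<rho> where \<rho>: "\<rho> analytic_on {z}" "\<rho> z = w z" "\<forall>\<^sub>F u in nhds z. G u = eval_mero f (\<rho> u)"
          using branch[of z] z by auto
        have "norm (w z) ^ p = norm z"
          using w[of z] norm_power[of "w z" p] by simp
        moreover have "norm z < e ^ p"
          using z by simp
        ultimately have "norm (w z) ^ p < e ^ p"
          by (simp only:)
        hence "norm (w z) < e"
          by (rule power_less_imp_less_base) (use e(1) in linarith)
        hence "{\<rho> z} \<subseteq> ball 0 e - {0}"
          using w_nz[of z] z \<rho>(2) by simp
        hence "eval_mero f analytic_on {\<rho> z}"
          by (rule analytic_on_subset[OF e(2)])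
        hence "(eval_mero f \<circ> \<rho>) analytic_on {z}"
          using \<rho>(1) by (intro analytic_on_compose) auto
        thus ?thesis
          unfolding analytic_at_cong[OF \<rho>(3) refl] by (simp add: o_def)
      qed
      hence "G analytic_on ball 0 (e ^ p) - {0}"
        using analytic_on_analytic_at by blast
      thus ?thesis
        using e(1) by (auto simp: isolated_singularity_at_def intro!: exI[of _ "e ^ p"])
    qed
    ultimately show ?thesis
      using True by (simp add: meromorphic_at_iff)
  qed
  hence mero: "G meromorphic_on UNIV"
    by (subst meromorphic_on_meromorphic_at) auto
  have "mero_pullback 1 p (mero_of_fun G) = f"
  proof (rule mero_eqI)
    have "\<forall>\<^sub>\<approx>z\<in>UNIV. eval_mero (mero_of_fun G) (1 * z ^ p) = G (1 * z ^ p)"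
      using eventually_eval_mero_of_fun[OF mero] p by (intro eventually_pullback) auto
    thus "\<forall>\<^sub>\<approx>z\<in>UNIV. eval_mero (mero_pullback 1 p (mero_of_fun G)) z = eval_mero f z"
    proof eventually_elim
      case (elim z)
      have "G (z ^ p) = eval_mero f z"
        unfolding G_def by (rule inv) (simp add: w)
      with elim p show ?case
        by (simp add: eval_mero_pullback)
    qed
  qed
  thus ?thesis ..
qed


section \<open>The minimal polynomial of a totally ramified function\<close>

text \<open>Total ramification at 0: \<open>F\<close> has leading term \<open>G 0 * x ^ r\<close>
  with r coprime to p, so the p rotations by powers of the primitive root \<open>\<omega>\<close>
  multiply its leading coefficient by p different roots of unity.\<close>

locale ramified =
  fixes p r :: nat and G :: "complex \<Rightarrow> complex" and F :: mero and \<omega> :: complex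
  assumes p: "p > 0" and coprime: "coprime r p"
    and G: "isCont G 0" "G 0 \<noteq> 0"
    and F: "\<forall>\<^sub>F x in at 0. eval_mero F x = x ^ r * G x"
  defines "\<omega> \<equiv> exp (2 * of_real pi * \<i> / of_nat p)"
begin

lemma \<omega>_power: "\<omega> ^ j = exp (2 * of_real pi * \<i> * of_nat j / of_nat p)"
  unfolding \<omega>_def by (simp flip: exp_of_nat_mult add: mult_ac)

lemma \<omega>_nz: "\<omega> ^ j \<noteq> 0"
  by (simp add: \<omega>_def)

lemma \<omega>_p: "\<omega> ^ p = 1"
  using p by (simp add: \<omega>_power)

lemma \<omega>_power_eq_1_iff: "\<omega> ^ j = 1 \<longleftrightarrow> p dvd j"
  using p complex_root_unity_eq_1[of p j] by (simp add: \<omega>_power)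

abbreviation conj :: "nat \<Rightarrow> mero" where
  "conj j \<equiv> mero_pullback (\<omega> ^ j) 1 F"

abbreviation \<iota> :: "mero \<Rightarrow> mero" where
  "\<iota> \<equiv> mero_pullback 1 p"

text \<open>Dividing the invariance of \<open>F\<close> by \<open>x ^ r\<close> and letting x tend
  to 0 gives \<open>\<omega> ^ (k * r) * G 0 = G 0\<close>. Hence p divides \<open>k * r\<close>,
  and coprimality removes r.\<close>

lemma conj_eq_self:
  assumes "conj k = F"
  shows   "p dvd k"
proof -
  have lim: "filterlim (\<lambda>x. \<omega> ^ k * x) (at 0) (at 0)"
    using filterlim_at_monomial[OF \<omega>_nz, of 1 k 0] by simp
  have inv: "eval_mero F (\<omega> ^ k * x) = eval_mero F x" for x
    using arg_cong[OF assms, of "\<lambda>f. eval_mero f x"] \<omega>_nz[of k] by (simp add: eval_mero_pullback)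
  have "\<forall>\<^sub>F x in at 0. eval_mero F (\<omega> ^ k * x) = (\<omega> ^ k * x) ^ r * G (\<omega> ^ k * x)"
    using F lim unfolding filterlim_iff by blast
  moreover have "\<forall>\<^sub>F x::complex in at 0. x \<noteq> 0"
    by (simp add: eventually_at_filter)
  ultimately have eq: "\<forall>\<^sub>F x in at 0. \<omega> ^ (k * r) * G (\<omega> ^ k * x) = G x"
    using F by eventually_elim (auto simp: inv power_mult_distrib power_mult)
  have G0: "(G \<longlongrightarrow> G 0) (at 0)"
    using G(1) by (simp add: isCont_def)
  have "((\<lambda>x. \<omega> ^ (k * r) * G (\<omega> ^ k * x)) \<longlongrightarrow> \<omega> ^ (k * r) * G 0) (at 0)"
    by (intro tendsto_intros filterlim_compose[OF G0 lim])
  hence "(G \<longlongrightarrow> \<omega> ^ (k * r) * G 0) (at 0)"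
    by (rule tendsto_cong[OF eq, THEN iffD1])
  hence "\<omega> ^ (k * r) * G 0 = G 0"
    using G0 by (rule tendsto_unique[rotated]) simp
  hence "p dvd k * r"
    using G(2) by (simp add: \<omega>_power_eq_1_iff)
  thus ?thesis
    using coprime by (simp add: coprime_dvd_mult_left_iff coprime_commute)
qed

lemma inj_conj: "inj_on conj {..<p}"
proof (rule linorder_inj_onI)
  fix i j assume ij: "i < j" "i \<in> {..<p}" "j \<in> {..<p}"
  show "conj i \<noteq> conj j"
  proof
    assume "conj i = conj j"
    \<comment> \<open>A further rotation by \<open>\<omega> ^ (p - i)\<close> undoes the i-th one
      and leaves \<open>conj (j - i)\<close> on the other side, since
      \<open>\<omega> ^ p = 1\<close>.\<close>
    hence "mero_pullback (\<omega> ^ (p - i)) 1 (conj i) = mero_pullback (\<omega> ^ (p - i)) 1 (conj j)"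
      by simp
    moreover have "\<omega> ^ i * \<omega> ^ (p - i) = \<omega> ^ 0" "\<omega> ^ j * \<omega> ^ (p - i) = \<omega> ^ (j - i)"
      using ij \<omega>_p by (simp_all flip: power_add)
         (metis add.commute diff_add_assoc2 less_imp_le_nat mult.right_neutral power_add)
    ultimately have "conj (j - i) = conj 0"
      unfolding mero_pullback_pullback[OF \<omega>_nz \<omega>_nz zero_less_one zero_less_one]
      by (simp only: power_one_right mult_1_right)
    hence "conj (j - i) = F" by simp
    hence "p dvd j - i" by (rule conj_eq_self)
    thus False using ij by (auto dest: dvd_imp_le)
  qed
qed auto

lemma F_nz: "F \<noteq> 0"
proof
  assume "F = 0"
  have "\<forall>\<^sub>F x in at 0. G x \<noteq> 0"
    using G by (intro tendsto_imp_eventually_ne[of G "G 0"]) (auto simp: isCont_def)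
  moreover have "\<forall>\<^sub>F x::complex in at 0. x \<noteq> 0"
    by (simp add: eventually_at_filter)
  ultimately have "\<forall>\<^sub>F x::complex in at 0. False"
    using F by eventually_elim (simp add: \<open>F = 0\<close> eval_mero_0)
  thus False by simp
qed

text \<open>Coefficients that depend on \<open>x ^ p\<close> alone are fixed by every rotation, so
  the root \<open>F\<close> brings its p distinct conjugates along as roots. The bound later yields
  both irreducibility and a nonzero constant term.\<close>

lemma annihilator_degree:
  assumes "A \<noteq> 0" "poly (map_poly \<iota> A) F = 0"
  shows   "degree A \<ge> p"
proof -
  have hom: "\<iota> 0 = 0" "\<And>x y. \<iota> (x + y) = \<iota> x + \<iota> y" "\<And>x. \<iota> x = 0 \<longleftrightarrow> x = 0"
    using p by (simp_all add: mero_pullback_add mero_pullback_eq_0_iff)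
  have nz: "map_poly \<iota> A \<noteq> 0"
    using assms(1) hom p by (simp add: map_poly_eq_0_iff)
  have "poly (map_poly \<iota> A) (conj j) = 0" for j
  proof -
    let ?s = "mero_pullback (\<omega> ^ j) 1"
    have "(\<omega> ^ j) ^ p = 1"
      by (metis \<omega>_p power_mult mult.commute power_one)
    hence "map_poly ?s (map_poly \<iota> A) = map_poly \<iota> A"
      using p \<omega>_nz[of j] by (intro poly_eqI) (simp add: coeff_map_poly mero_pullback_pullback)
    thus ?thesis
      using poly_map_poly_hom[of ?s "map_poly \<iota> A" F] assms(2) \<omega>_nz[of j]
      by (simp add: mero_pullback_add mero_pullback_mult)
  qed
  hence "conj ` {..<p} \<subseteq> {x. poly (map_poly \<iota> A) x = 0}" by blast
  hence "card (conj ` {..<p}) \<le> card {x. poly (map_poly \<iota> A) x = 0}"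
    by (intro card_mono poly_roots_finite nz)
  also have "\<dots> \<le> degree (map_poly \<iota> A)"
    by (rule card_poly_roots_bound[OF nz])
  also have "\<dots> = degree A"
    by (rule degree_map_poly) (simp add: hom)
  finally show ?thesis
    by (simp only: card_image[OF inj_conj] card_lessThan)
qed

lemma exists_annihilator: "\<exists>Q. degree Q = p \<and> poly (map_poly \<iota> Q) F = 0"
proof -
  define P where "P = (\<Prod>j<p. [:- conj j, 1:])"
  let ?s = "mero_pullback \<omega> 1"
  have \<omega>: "\<omega> \<noteq> 0" using \<omega>_nz[of 1] by simp
  have s_P: "map_poly ?s P = P"
  proof -
    obtain q where q: "p = Suc q"
      using p gr0_conv_Suc by blast
    \<comment> \<open>Rotation by \<open>\<omega>\<close> permutes the factors cyclically: index j
      moves to \<open>Suc j\<close>, and the last one, p, wraps around to 0.\<close>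
    have "map_poly ?s P = (\<Prod>j<p. map_poly ?s [:- conj j, 1:])"
      unfolding P_def using \<omega>
      by (intro map_poly_prod_hom) (simp_all add: mero_pullback_add mero_pullback_mult)
    also have "\<dots> = (\<Prod>j<p. [:- conj (Suc j), 1:])"
      using \<omega> \<omega>_nz
      by (simp add: map_poly_pCons mero_pullback_minus mero_pullback_pullback mult.commute)
    also have "\<dots> = (\<Prod>j<q. [:- conj (Suc j), 1:]) * [:- conj p, 1:]"
      by (simp add: q)
    also have "conj p = conj 0"
      using \<omega>_p by simp
    also have "(\<Prod>j<q. [:- conj (Suc j), 1:]) * [:- conj 0, 1:] = P"
      unfolding P_def q by (subst prod.lessThan_Suc_shift) (simp add: mult.commute)
    finally show ?thesis .
  qed
  have "\<exists>g. \<iota> g = coeff P k" for k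
  proof (rule mero_descent[OF p])
    fix x y :: complex assume xy: "x ^ p = y ^ p"
    define c where "c = coeff P k"
    have "?s c = c"
      using arg_cong[OF s_P, of "\<lambda>p. coeff p k"] \<omega> by (simp add: coeff_map_poly c_def)
    hence step: "eval_mero c (\<omega> * z) = eval_mero c z" for z
      using eval_mero_pullback[of \<omega> 1 c z] \<omega> by simp
    \<comment> \<open>Points with equal p-th powers differ by a power of \<open>\<omega>\<close>, so
      invariance under one rotation has to be iterated.\<close>
    have rot: "eval_mero c (\<omega> ^ j * z) = eval_mero c z" for j z
      by (induction j) (simp_all add: mult.assoc step)
    show "eval_mero (coeff P k) x = eval_mero (coeff P k) y"
    proof (cases "y = 0")
      case False
      hence "(x / y) ^ p = 1"
        using xy by (simp add: power_divide)
      then obtain j where "x / y = \<omega> ^ j"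
        using complex_roots_unity[of p] p by (auto simp: \<omega>_power)
      hence "x = \<omega> ^ j * y"
        using False by (simp add: field_simps)
      thus ?thesis using rot[of j y] by (simp add: c_def)
    next
      case True
      with xy p have "x = 0" by (simp add: zero_power)
      with True show ?thesis by simp
    qed
  qed
  then obtain g where g: "\<And>k. \<iota> (g k) = coeff P k" by metis
  have deg_P: "degree P = p"
    unfolding P_def by (subst degree_prod_eq_sum_degree) auto
  \<comment> \<open>Cutting the family \<open>g\<close> off after index p gives a polynomial without
    loss, as \<open>P\<close> has degree p.\<close>
  define Q where "Q = Poly (map g [0..<Suc p])"
  have "map_poly \<iota> Q = P"
  proof (rule poly_eqI)
    fix k
    have "coeff P k = 0" if "k > p"
      using that deg_P by (intro coeff_eq_0) auto
    thus "coeff (map_poly \<iota> Q) k = coeff P k"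
      using p by (auto simp: Q_def coeff_map_poly coeff_Poly_eq nth_default_def g simp del: upt_Suc)
  qed
  moreover have "degree (map_poly \<iota> Q) = degree Q"
    using p by (intro degree_map_poly) (simp add: mero_pullback_eq_0_iff)
  moreover have "poly P F = 0"
    unfolding P_def poly_prod using p by (auto intro!: bexI[of _ 0])
  ultimately show ?thesis
    using deg_P by metis
qed

text \<open>In any factorization one factor annihilates \<open>F\<close>, since the field has no
  zero divisors. By \<open>annihilator_degree\<close> that factor uses up the whole degree p,
  leaving a constant cofactor.\<close>

lemma irreducible_annihilator:
  assumes "degree Q = p" "poly (map_poly \<iota> Q) F = 0"
  shows   "irreducible Q"
proof (rule irreducibleI)
  show "Q \<noteq> 0" using assms p by auto
  thus "\<not> Q dvd 1" using assms(1) p by (simp add: is_unit_iff_degree)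
next
  fix A B assume Q: "Q = A * B"
  have nz: "A \<noteq> 0" "B \<noteq> 0" using Q assms p by auto
  have "map_poly \<iota> Q = map_poly \<iota> A * map_poly \<iota> B"
    unfolding Q using p by (intro map_poly_mult_hom) (simp_all add: mero_pullback_add mero_pullback_mult)
  hence "poly (map_poly \<iota> A) F = 0 \<or> poly (map_poly \<iota> B) F = 0"
    using assms(2) by simp
  hence "degree A \<ge> p \<or> degree B \<ge> p"
    using annihilator_degree nz by blast
  hence "degree A = 0 \<or> degree B = 0"
    using assms(1) Q degree_mult_eq[OF nz] by auto
  thus "A dvd 1 \<or> B dvd 1"
    using nz by (auto simp: is_unit_iff_degree)
qed

lemma exists_algebroid_poly:
  "\<exists>g. irreducible (algebroid_poly p g) \<and> (\<Sum>k=1..p. \<iota> (g k) * F ^ k) = 1"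
proof -
  obtain Q where Q: "degree Q = p" "poly (map_poly \<iota> Q) F = 0"
    using exists_annihilator by blast
  note irr = irreducible_annihilator[OF Q]
  \<comment> \<open>Otherwise the unknown could be split off and, as \<open>F\<close> is nonzero,
    the remaining quotient would annihilate \<open>F\<close> in degree below p.\<close>
  have c0: "coeff Q 0 \<noteq> 0"
  proof
    assume "coeff Q 0 = 0"
    then obtain R where R: "Q = pCons 0 R" by (metis coeff_pCons_0 pCons_cases)
    hence nz: "R \<noteq> 0" using Q(1) p by auto
    have "poly (map_poly \<iota> R) F = 0"
      using Q(2) F_nz p by (simp add: R map_poly_pCons)
    hence "degree R \<ge> p" by (rule annihilator_degree[OF nz])
    thus False using Q(1) R nz by simp
  qed
  \<comment> \<open>The scaling makes the constant term -1, as in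
    \<open>algebroid_poly\<close>.\<close>
  define R where "R = smult (- inverse (coeff Q 0)) Q"
  have R: "degree R = p" "poly (map_poly \<iota> R) F = 0" "coeff R 0 = -1"
  proof -
    show "degree R = p" using Q c0 by (simp add: R_def)
    have "map_poly \<iota> R = smult (\<iota> (- inverse (coeff Q 0))) (map_poly \<iota> Q)"
      unfolding R_def using p by (intro poly_eqI)
        (simp add: coeff_map_poly del: mult_minus_left flip: mero_pullback_mult)
    thus "poly (map_poly \<iota> R) F = 0" using Q(2) by simp
    show "coeff R 0 = -1" using c0 by (simp add: R_def)
  qed
  have eq: "algebroid_poly p (coeff R) = R"
    by (rule poly_eqI) (auto simp: coeff_algebroid_poly R coeff_eq_0)
  have "degree (map_poly \<iota> R) = p"
    using p R(1) degree_map_poly[of \<iota> R] by (simp add: mero_pullback_eq_0_iff)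
  hence "0 = (\<Sum>k\<le>p. \<iota> (coeff R k) * F ^ k)"
    using R(2) p by (simp add: poly_altdef coeff_map_poly)
  also have "{..p} = insert 0 {1..p}" by auto
  also have "(\<Sum>k\<in>insert 0 {1..p}. \<iota> (coeff R k) * F ^ k) =
             (\<Sum>k=1..p. \<iota> (coeff R k) * F ^ k) - 1"
    using p by (subst sum.insert) (auto simp: R mero_pullback_minus)
  finally have "(\<Sum>k=1..p. \<iota> (coeff R k) * F ^ k) = 1" by simp
  moreover have "irreducible (algebroid_poly p (coeff R))"
    using irreducible_annihilator[OF R(1,2)] eq by simp
  ultimately show ?thesis by blast
qed

end

section \<open>From identities in the field to pointwise identities in x and in s = ln t\<close>

lemma isCont_nicely_meromorphic:
  assumes "f nicely_meromorphic_on UNIV" "\<not> is_pole f z"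
  shows   "isCont f z"
  using assms analytic_at_imp_isCont nicely_meromorphic_on_imp_analytic_at by blast

lemma exists_algebroid_equation:
  fixes H :: "complex \<Rightarrow> complex" and C :: complex
  assumes "p > 0" "coprime r p" "C \<noteq> 0"
    and H: "H nicely_meromorphic_on UNIV" "isCont H 0" "H 0 \<noteq> 0"
  shows "\<exists>g. irreducible (algebroid_poly p g) \<and>
           (\<forall>x. \<not> is_pole H x \<and> (\<forall>k\<in>{1..p}. \<not> is_pole (eval_mero (g k)) (x ^ p)) \<longrightarrow>
             (\<Sum>k=1..p. eval_mero (g k) (x ^ p) * (C * x ^ r * H x) ^ k) = 1)"
proof -
  define f where "f = (\<lambda>x. C * x ^ r * H x)"
  have "H meromorphic_on UNIV"
    using H(1) by (simp add: nicely_meromorphic_on_def)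
  hence f: "f meromorphic_on UNIV"
    unfolding f_def by (intro meromorphic_intros)
  define F where "F = mero_of_fun f"
  have eval_F: "\<forall>\<^sub>\<approx>x\<in>UNIV. eval_mero F x = f x"
    unfolding F_def by (rule eventually_eval_mero_of_fun[OF f])
  interpret ramified p r "\<lambda>x. C * H x" F "exp (2 * of_real pi * \<i> / of_nat p)"
  proof unfold_locales
    show "\<forall>\<^sub>F x in at 0. eval_mero F x = x ^ r * (C * H x)"
      using eval_F by (auto simp: eventually_cosparse_open_eq f_def mult_ac)
    show "isCont (\<lambda>x. C * H x) 0"
      using H(2) by (intro continuous_intros)
  qed (use assms in simp_all)
  obtain g where g: "irreducible (algebroid_poly p g)"
      "(\<Sum>k=1..p. mero_pullback 1 p (g k) * F ^ k) = 1"
    using exists_algebroid_poly by blast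
  have "\<forall>\<^sub>\<approx>x\<in>UNIV. \<forall>k\<in>{1..p}. eval_mero (mero_pullback 1 p (g k) * F ^ k) x =
          eval_mero (g k) (x ^ p) * f x ^ k"
  proof (intro eventually_ball_finite ballI)
    fix k
    show "\<forall>\<^sub>\<approx>x\<in>UNIV. eval_mero (mero_pullback 1 p (g k) * F ^ k) x = eval_mero (g k) (x ^ p) * f x ^ k"
      using eval_mero_mult[of "mero_pullback 1 p (g k)" "F ^ k"] eventually_eval_mero_power[of F k] eval_F
      by eventually_elim (use \<open>p > 0\<close> in \<open>simp add: eval_mero_pullback\<close>)
  qed auto
  with eventually_eval_mero_sum[of "\<lambda>k. mero_pullback 1 p (g k) * F ^ k" "{1..p}"]
  have generic: "\<forall>\<^sub>\<approx>x\<in>UNIV. (\<Sum>k=1..p. eval_mero (g k) (x ^ p) * f x ^ k) = 1"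
  proof eventually_elim
    case (elim x)
    have "(\<Sum>k=1..p. eval_mero (g k) (x ^ p) * f x ^ k) =
          (\<Sum>k=1..p. eval_mero (mero_pullback 1 p (g k) * F ^ k) x)"
      using elim(2) by (intro sum.cong) auto
    also have "\<dots> = 1"
      unfolding elim(1)[symmetric] g(2) by (rule eval_mero_1)
    finally show ?case .
  qed
  \<comment> \<open>The field identity holds only off a sparse set; continuity away from poles and
    uniqueness of limits extend it to x.\<close>
  have "(\<Sum>k=1..p. eval_mero (g k) (x ^ p) * f x ^ k) = 1"
    if x: "\<not> is_pole H x" "\<forall>k\<in>{1..p}. \<not> is_pole (eval_mero (g k)) (x ^ p)" for x
  proof -
    have "((\<lambda>x. eval_mero (g k) (x ^ p)) \<longlongrightarrow> eval_mero (g k) (x ^ p)) (at x)" if "k \<in> {1..p}" for k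
    proof (rule isCont_tendsto_compose[of "x ^ p" "eval_mero (g k)"])
      show "isCont (eval_mero (g k)) (x ^ p)"
        using x(2) that by (intro isCont_nicely_meromorphic eval_mero_nicely) blast
    qed (intro tendsto_intros)
    moreover have "(H \<longlongrightarrow> H x) (at x)"
      using isCont_nicely_meromorphic[OF H(1) x(1)] by (rule isContD)
    ultimately have "((\<lambda>x. \<Sum>k=1..p. eval_mero (g k) (x ^ p) * f x ^ k) \<longlongrightarrow>
        (\<Sum>k=1..p. eval_mero (g k) (x ^ p) * f x ^ k)) (at x)" (is "(?S \<longlongrightarrow> ?s) _")
      unfolding f_def by (intro tendsto_intros)
    moreover have "(?S \<longlongrightarrow> 1) (at x)"
      using generic by (intro tendsto_eventually) (auto simp: eventually_cosparse_open_eq)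
    ultimately show ?thesis
      by (rule tendsto_unique[rotated]) simp
  qed
  thus ?thesis
    using g(1) unfolding f_def by blast
qed

lemma exists_algebroid_identity:
  fixes H z y :: "complex \<Rightarrow> complex" and C b :: complex and \<alpha> :: real
  assumes "p > 0" "coprime r p" "C \<noteq> 0" "b \<noteq> 0" "\<alpha> \<noteq> 0"
    and H: "H nicely_meromorphic_on UNIV" "isCont H 0" "H 0 \<noteq> 0"
    and z: "\<And>s. z s = (b * exp (of_real \<alpha> * s)) ^ p"
    and y: "\<And>s. exp s * y s = C * (b * exp (of_real \<alpha> * s)) ^ r * H (b * exp (of_real \<alpha> * s))"
  shows "\<exists>g. algebroid_identity p g z y \<and> irreducible (algebroid_poly p g)"
proof -
  define x where "x = (\<lambda>s. b * exp (of_real \<alpha> * s))"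
  obtain g where g: "irreducible (algebroid_poly p g)"
    "\<And>x. \<not> is_pole H x \<Longrightarrow> (\<And>k. k \<in> {1..p} \<Longrightarrow> \<not> is_pole (eval_mero (g k)) (x ^ p)) \<Longrightarrow>
         (\<Sum>k=1..p. eval_mero (g k) (x ^ p) * (C * x ^ r * H x) ^ k) = 1"
    using exists_algebroid_equation[OF assms(1-3) H] by blast
  have pole: "is_pole y s" if "is_pole H (x s)" for s
  proof -
    \<comment> \<open>The derivative never vanishes, so \<open>x\<close> avoids the value
      \<open>x s\<close> near s, as composition with a pole requires. The remaining factor of
      \<open>y\<close> is analytic and zero-free, so the pole persists.\<close>
    have "(x has_field_derivative b * (exp (of_real \<alpha> * s) * of_real \<alpha>)) (at s)"
      unfolding x_def by (auto intro!: derivative_eq_intros)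
    hence "((\<lambda>u. (x u - x s) / (u - s)) \<longlongrightarrow> b * (exp (of_real \<alpha> * s) * of_real \<alpha>)) (at s)"
      by (simp add: has_field_derivative_iff)
    hence "\<forall>\<^sub>F u in at s. (x u - x s) / (u - s) \<noteq> 0"
      by (rule tendsto_imp_eventually_ne) (use assms in simp)
    hence "\<forall>\<^sub>F u in at s. x u \<noteq> x s"
      by eventually_elim auto
    moreover have "x \<midarrow>s\<rightarrow> x s"
      unfolding x_def by (intro tendsto_intros)
    ultimately have "is_pole (\<lambda>u. H (x u)) s"
      using is_pole_compose[OF that] by blast
    hence "is_pole (\<lambda>u. (C * x u ^ r / exp u) * H (x u)) s"
      using assms unfolding x_def
      by (intro is_pole_mult_analytic_nonzero1 analytic_intros) auto
    also have "(\<lambda>u. (C * x u ^ r / exp u) * H (x u)) = y"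
      using y unfolding x_def by (auto simp: fun_eq_iff field_simps)
    finally show ?thesis .
  qed
  have "algebroid_identity p g z y"
    unfolding algebroid_identity_def z y
  proof (intro allI impI, elim conjE)
    fix s
    assume "\<not> is_pole y s"
    hence "\<not> is_pole H (x s)" using pole by blast
    moreover assume "\<forall>k\<in>{1..p}. \<not> is_pole (eval_mero (g k)) ((b * exp (of_real \<alpha> * s)) ^ p)"
    ultimately have "(\<Sum>k=1..p. eval_mero (g k) (x s ^ p) * (C * x s ^ r * H (x s)) ^ k) = 1"
      by (intro g(2)) (unfold x_def, blast+)
    thus "(\<Sum>k=1..p. eval_mero (g k) ((b * exp (of_real \<alpha> * s)) ^ p) *
            (C * (b * exp (of_real \<alpha> * s)) ^ r * H (b * exp (of_real \<alpha> * s))) ^ k) - 1 = 0"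
      unfolding x_def by (simp only: diff_self)
  qed
  with g(1) show ?thesis by blast
qed

section \<open>Application to the two series of solutions\<close>

lemma c_plus_power: "1 / c_plus n ^ (2 * n + 3) = ((2 * real n + 3) / 4) ^ 6"
proof -
  define c where "c = c_plus n"
  define N where "N = 2 * real n + 3"
  have c: "c > 0" "(N / 4) ^ 2 * c powr (N / 3) = 1"
    using c_plus[of n] by (simp_all add: c_def N_def)
  \<comment> \<open>Cubing the defining equation of \<open>c_plus\<close> clears the denominator 3
    in the exponent.\<close>
  have "((N / 4) ^ 2 * c powr (N / 3)) ^ 3 = (N / 4) ^ 6 * c powr N"
    using c(1) by (simp add: power_mult_distrib powr_power flip: power_mult)
  moreover have "c powr N = c ^ (2 * n + 3)"
    using c(1) by (simp add: N_def powr_realpow[symmetric])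
  ultimately have "(N / 4) ^ 6 * c ^ (2 * n + 3) = 1"
    using c(2) by simp
  thus ?thesis
    using c(1) unfolding c_def N_def by (simp add: field_simps)
qed

text \<open>Here r = n + 1 and p = 2n + 3, coprime because (2n + 3) - 2(n + 1) = 1. The case n = 0
  is covered as well and supplies the member m = 0 of the other series.\<close>

lemma plus_series:
  assumes "a0 \<noteq> 0" "is_H_plus a0 n H"
  shows "\<exists>g. algebroid_identity (2 * n + 3) g
            (\<lambda>s. of_real (((2 * real n + 3) / 4) ^ 6) * exp s ^ 4) (y_plus n H) \<and>
          irreducible (algebroid_poly (2 * n + 3) g)"
proof -
  define \<alpha> where "\<alpha> = 4 / (2 * real n + 3)"
  define b where "b = complex_of_real (1 / c_plus n)"
  \<comment> \<open>The factor \<open>c_plus n ^ (n + 1)\<close> compensates for the power of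
    \<open>b\<close> contained in \<open>x ^ (n + 1)\<close>.\<close>
  define C where "C = complex_of_real (c_plus n powr (- real n / 3) * c_plus n ^ (n + 1))"
  have c: "c_plus n > 0" by (rule c_plus)
  have "coprime (n + 1) (2 * n + 3)"
  proof (rule coprimeI)
    fix d assume "d dvd n + 1" "d dvd 2 * n + 3"
    hence "d dvd (2 * n + 3) - 2 * (n + 1)"
      by (intro dvd_diff_nat dvd_mult)
    thus "is_unit d" by simp
  qed
  moreover have "H nicely_meromorphic_on UNIV" "isCont H 0" "H 0 \<noteq> 0"
    using assms by (auto simp: is_H_plus_def H_plus_eq_def analytic_at_imp_isCont)
  moreover have "b \<noteq> 0" "\<alpha> \<noteq> 0" "C \<noteq> 0"
    using c by (simp_all add: \<alpha>_def b_def C_def)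
  moreover have "of_real (((2 * real n + 3) / 4) ^ 6) * exp s ^ 4 =
        (b * exp (of_real \<alpha> * s)) ^ (2 * n + 3)" for s
  proof -
    have "real (2 * n + 3) * \<alpha> = 4"
      by (simp add: \<alpha>_def field_simps)
    moreover have "exp (of_real \<alpha> * s) ^ (2 * n + 3) = exp (of_real (real (2 * n + 3) * \<alpha>) * s)"
      unfolding exp_of_nat_mult[symmetric] by (simp only: of_real_mult of_real_of_nat_eq mult.assoc)
    ultimately have "exp (of_real \<alpha> * s) ^ (2 * n + 3) = exp s ^ 4"
      by (simp only:) (simp flip: exp_of_nat_mult)
    thus ?thesis
      unfolding c_plus_power[symmetric] power_mult_distrib b_def by (simp add: power_divide)
  qed
  moreover have "exp s * y_plus n H s =
     C * (b * exp (of_real \<alpha> * s)) ^ (n + 1) * H (b * exp (of_real \<alpha> * s))" for s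
  proof -
    have "4 * (real n + 1) / (2 * real n + 3) = real (n + 1) * \<alpha>"
      by (simp add: \<alpha>_def)
    hence "exp (of_real (4 * (real n + 1) / (2 * real n + 3)) * s) = exp (of_real \<alpha> * s) ^ (n + 1)"
      unfolding exp_of_nat_mult[symmetric] by (simp only: of_real_mult of_real_of_nat_eq mult.assoc)
    thus ?thesis
      using c unfolding y_plus_def \<alpha>_def[symmetric] b_def C_def
      by (simp add: power_mult_distrib field_simps)
  qed
  ultimately show ?thesis
    by (intro exists_algebroid_identity[where r = "n + 1" and C = C and b = b and \<alpha> = \<alpha>]) simp_all
qed

text \<open>Now r = 1, so p may be any positive number; dividing m + 3 and 4 by their gcd gives the
  least p for which \<open>x ^ p\<close> is an integral power of t.\<close>

lemma minus_series:
  assumes "a0 \<noteq> 0" "is_H_minus a0 m H" "d = gcd (m + 3) 4" "p = (m + 3) div d"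
  shows "\<exists>g. algebroid_identity p g
            (\<lambda>s. of_real (1 / c_minus m ^ p) * exp s ^ (4 div d)) (y_minus m H) \<and>
          irreducible (algebroid_poly p g)"
proof -
  define \<alpha> where "\<alpha> = 4 / (real m + 3)"
  define b where "b = complex_of_real (1 / c_minus m)"
  define C where "C = complex_of_real (c_minus m powr (real m / 3) * c_minus m)"
  have c: "c_minus m > 0" by (rule c_minus)
  have "d dvd m + 3" "d dvd 4" "d > 0"
    using assms(3) by (simp_all only: gcd_dvd1 gcd_dvd2) simp
  hence d: "p * d = m + 3" "4 div d * d = 4"
    by (simp_all add: assms(4))
  hence d': "real m + 3 = real p * real d" "4 = real (4 div d) * real d"
    by (metis of_nat_add of_nat_mult of_nat_numeral)+
  have "p > 0" using d by (cases p) auto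
  hence \<alpha>: "real p * \<alpha> = real (4 div d)"
    using \<open>d > 0\<close> unfolding \<alpha>_def d'(1) by (subst d'(2)) simp
  note \<open>p > 0\<close>
  moreover have "H nicely_meromorphic_on UNIV" "isCont H 0" "H 0 \<noteq> 0"
    using assms by (auto simp: is_H_minus_def H_minus_eq_def analytic_at_imp_isCont)
  moreover have "b \<noteq> 0" "\<alpha> \<noteq> 0" "C \<noteq> 0"
    using c by (simp_all add: \<alpha>_def b_def C_def)
  moreover have "of_real (1 / c_minus m ^ p) * exp s ^ (4 div d) = (b * exp (of_real \<alpha> * s)) ^ p" for s
  proof -
    have "exp (of_real \<alpha> * s) ^ p = exp (of_real (real p * \<alpha>) * s)"
      by (simp flip: exp_of_nat_mult add: mult.assoc)
    also have "\<dots> = exp s ^ (4 div d)"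
      unfolding \<alpha> by (simp flip: exp_of_nat_mult)
    finally show ?thesis
      unfolding power_mult_distrib b_def by (simp add: power_divide)
  qed
  moreover have "exp s * y_minus m H s =
     C * (b * exp (of_real \<alpha> * s)) ^ 1 * H (b * exp (of_real \<alpha> * s))" for s
    using c unfolding y_minus_def \<alpha>_def[symmetric] b_def C_def by (simp add: field_simps)
  ultimately show ?thesis
    by (intro exists_algebroid_identity[where r = 1 and C = C and b = b and \<alpha> = \<alpha>]) simp_all
qed

theorem proposition3p7:
  fixes a0 :: complex
  assumes "a0 \<noteq> 0"
  shows
    "(\<forall>n\<ge>1. \<forall>H. is_H_plus a0 n H \<longrightarrow>
       (\<exists>g :: nat \<Rightarrow> mero.
          algebroid_identity (2 * n + 3) g
            (\<lambda>s. of_real (((2 * real n + 3) / 4) ^ 6) * exp s ^ 4) (y_plus n H) \<and>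
          irreducible (algebroid_poly (2 * n + 3) g)))
     \<and>
     (\<forall>m d p. d = gcd (m + 3) 4 \<longrightarrow> p = (m + 3) div d \<longrightarrow>
       (\<forall>H. is_H_mseries a0 m H \<longrightarrow>
         (\<exists>g :: nat \<Rightarrow> mero.
            algebroid_identity p g
              (\<lambda>s. of_real (1 / c_mseries m ^ p) * exp s ^ (4 div d)) (y_mseries m H) \<and>
            irreducible (algebroid_poly p g))))"
proof (intro conjI allI impI)
  fix n H assume "is_H_plus a0 n H"
  thus "\<exists>g. algebroid_identity (2 * n + 3) g
            (\<lambda>s. of_real (((2 * real n + 3) / 4) ^ 6) * exp s ^ 4) (y_plus n H) \<and>
          irreducible (algebroid_poly (2 * n + 3) g)"
    by (rule plus_series[OF assms])
next
  fix m d p :: nat and H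
  assume d: "d = gcd (m + 3) 4" and p: "p = (m + 3) div d" and H: "is_H_mseries a0 m H"
  show "\<exists>g. algebroid_identity p g
              (\<lambda>s. of_real (1 / c_mseries m ^ p) * exp s ^ (4 div d)) (y_mseries m H) \<and>
            irreducible (algebroid_poly p g)"
  proof (cases "m = 0")
    case True
    \<comment> \<open>For m = 0 both series prescribe p = 3 and the fourth power of t, and the
      constants in z agree by \<open>c_plus_power\<close>.\<close>
    have "gcd 3 (4 :: nat) = 1" by (simp add: gcd_non_0_nat)
    hence "d = 1" "p = 3" using d p True by simp_all
    moreover have "((2 * real 0 + 3) / 4) ^ 6 = 1 / c_plus 0 ^ 3"
      using c_plus_power[of 0] by simp
    ultimately show ?thesis
      using plus_series[OF assms, of 0 H] H True
      by (simp add: is_H_mseries_def c_mseries_def y_mseries_def)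
  next
    case False
    thus ?thesis
      using minus_series[OF assms _ d p] H
      by (simp add: is_H_mseries_def c_mseries_def y_mseries_def)
  qed
qed

end
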